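(* Let $\alpha=\frac{\log 3}{2\log(1+\sqrt2)}$. The function $Q_E:[0,1]\to[0,1]$ is Hölder continuous with best exponent $\alpha$; that is, there is a constant $C>0$ with $|Q_E(x)-Q_E(x')|\le C|x-x'|^{\alpha}$ for all $x,x'\in[0,1]$, and for no $\beta>\alpha$ is $Q_E$ Hölder continuous with exponent $\beta$.
   Context: Even continued fractions (ECF). Write $$[(e_1,a_1),(e_2,a_2),\ldots,(e_n,a_n)]=\cfrac{e_1}{a_1+\cfrac{e_2}{a_2+\cdots+\cfrac{e_n}{a_n}}}.$$ A finite ECF expansion has $e_i\in\{\pm1\}$ and every $a_i$ a positive even integer, except that the last partial quotient $a_n$ is also allowed to equal $1$ provided $e_n=1$. For numbers in $(0,1]$ one has $e_1=1$. With this convention every rational in $(0,1]$ has a unique finite ECF expansion; $0$ has the empty expansion. For $k\ge 0$ let $\mathcal{Y}_k$ be the set of rationals in $[0,1]$ whose finite ECF expansion satisfies $a_1+\cdots+a_n\le 2k+1$ (in particular $0,1\in\mathcal{Y}_k$); it has $3^k+1$ elements. For $x\in\mathcal{Y}_k$ define $Q_E(x)=3^{-k}|\{y\in\mathcal{Y}_k: y<x\}|$, which does not depend on the choice of $k$ with $x\in\mathcal{Y}_k$. For arbitrary $x\in[0,1]$, $Q_E(x)=\lim_{n\to\infty}3^{-n}|\{y\in\mathcal{Y}_n:y<x\}|$, which agrees with the previous definition for rational $x$ and is the extension of $Q_E$ from $\mathbb{Q}\cap[0,1]$ to $[0,1]$ by continuity. *)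

theory Defs
  imports Complex_Main
begin

text \<open>A finite continued fraction is a list of pairs \<open>(e\<^sub>i, a\<^sub>i)\<close>.\<close>

fun ecf_value :: "(int \<times> nat) list \<Rightarrow> real" where
  "ecf_value [] = 0"
| "ecf_value ((e, a) # ps) = of_int e / (real a + ecf_value ps)"

definition finite_ecf :: "(int \<times> nat) list \<Rightarrow> bool" where
  "finite_ecf ps \<longleftrightarrow>
     (\<forall>i < length ps. case ps ! i of (e, a) \<Rightarrow>
        e \<in> {1, -1} \<and>
        (0 < a \<and> even a \<or> i = length ps - 1 \<and> a = 1 \<and> e = 1))"

definition ecf_expansion :: "real \<Rightarrow> (int \<times> nat) list \<Rightarrow> bool" where
  "ecf_expansion x ps \<longleftrightarrow>
     finite_ecf ps \<and> (ps \<noteq> [] \<longrightarrow> fst (hd ps) = 1) \<and> ecf_value ps = x"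

text \<open>Since a rational in \<open>[0, 1]\<close> has exactly one finite expansion, the existential
  quantifier below speaks about that expansion.\<close>

definition Y :: "nat \<Rightarrow> real set" where
  "Y k = {x \<in> \<rat> \<inter> {0..1}. \<exists>ps. ecf_expansion x ps \<and> (\<Sum>(e, a)\<leftarrow>ps. a) \<le> 2 * k + 1}"

text \<open>For \<open>x \<in> Y k\<close> the sequence is constant from index \<open>k\<close> on, so the limit is
  \<open>3\<^sup>-\<^sup>k\<close> times the number of elements of \<open>Y k\<close> below \<open>x\<close>.
  The value is meaningful only for \<open>x\<close> in \<open>[0, 1]\<close>.\<close>

definition Q_E :: "real \<Rightarrow> real" where
  "Q_E x = lim (\<lambda>n. real (card {y \<in> Y n. y < x}) / 3 ^ n)"

definition holder_on :: "real \<Rightarrow> real set \<Rightarrow> (real \<Rightarrow> real) \<Rightarrow> bool" where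
  "holder_on b S f \<longleftrightarrow>
     (\<exists>C>0. \<forall>x\<in>S. \<forall>x'\<in>S. \<bar>f x - f x'\<bar> \<le> C * \<bar>x - x'\<bar> powr b)"

end

theory Submission
  imports Defs
begin

text \<open>
  Changing the first digit pair of an expansion, or putting a new one in front, yields three
  maps of \<open>[0, 1]\<close> to itself: \<open>x / (1 + 2x)\<close>, which adds \<open>2\<close> to the first partial quotient,
  and \<open>1 / (2 + x)\<close> and \<open>1 / (2 - x)\<close>, which prepend a partial quotient \<open>2\<close>. Their images
  \<open>[0, 1/3]\<close>, \<open>[1/3, 1/2]\<close>, \<open>[1/2, 1]\<close> tile the unit interval, and the set \<open>Y (n + 1)\<close> is the
  union of the images of \<open>Y n\<close> (\<open>Y_Suc\<close>). So \<open>Y n\<close> cuts \<open>[0, 1]\<close> into \<open>3\<^sup>n\<close> intervals, each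
  of which is cut into three by \<open>Y (n + 1)\<close>. With \<open>N\<close> the number of points of \<open>Y n\<close> below \<open>x\<close>,
  it follows that \<open>N / 3\<^sup>n\<close> decreases and \<open>(N - 1) / 3\<^sup>n\<close> increases with \<open>n\<close>
  (\<open>count_refine\<close>). Hence the limit exists and differs from each \<open>N / 3\<^sup>n\<close> by at most \<open>3\<^sup>-\<^sup>n\<close>
  (\<open>Q_E_le\<close>, \<open>Q_E_ge\<close>).

  Let \<open>\<mu> = 1 + sqrt 2\<close>, so that \<open>\<mu>\<^sup>2 = 1 + 2\<mu>\<close>. On a fraction \<open>p / q\<close> of the unit interval each of
  the three maps multiplies the linear form \<open>p + \<mu> q\<close> by at most \<open>\<mu>\<close>; the points of \<open>Y n\<close>
  therefore have denominators of size at most \<open>\<mu>\<^sup>n\<^sup>+\<^sup>1\<close>, and two of them are at least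
  \<open>\<mu>\<close> to the power \<open>-2(n + 1)\<close> apart (\<open>Y_separated\<close>). If \<open>x\<close> and \<open>y\<close> are closer than this,
  at most one point of \<open>Y n\<close> lies between them, and their values differ by at most \<open>2 / 3\<^sup>n\<close>. As
  \<open>\<mu>\<close> to the power \<open>2\<alpha>\<close> is \<open>3\<close>, this is the Hoelder bound with exponent \<open>\<alpha>\<close>.

  The map \<open>1 / (2 + x)\<close> multiplies the form \<open>p + \<mu> q\<close> by exactly \<open>\<mu>\<close>, and it turns
  \<open>Q_E\<close> into \<open>2/3 - Q_E / 3\<close>. Its iterates map \<open>0\<close> and \<open>1\<close> to two points whose values differ by
  exactly \<open>3\<^sup>-\<^sup>n\<close>, while the points themselves are within \<open>2\<close> times \<open>\<mu>\<close> to the power \<open>-2n\<close>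
  (\<open>br_plus_iterate_close\<close>). This excludes every exponent larger than \<open>\<alpha>\<close>.
\<close>

section \<open>The three branches of even continued fractions\<close>

definition br_add :: "real \<Rightarrow> real" where "br_add x = x / (1 + 2 * x)"
definition br_plus :: "real \<Rightarrow> real" where "br_plus x = 1 / (2 + x)"
definition br_minus :: "real \<Rightarrow> real" where "br_minus x = 1 / (2 - x)"

abbreviation ecf_sum :: "(int \<times> nat) list \<Rightarrow> nat" where
  "ecf_sum ps \<equiv> (\<Sum>(e, a)\<leftarrow>ps. a)"

lemma finite_ecf_Nil: "finite_ecf []"
  by (simp add: finite_ecf_def)

lemma finite_ecf_Cons:
  "finite_ecf ((e, a) # ps) \<longleftrightarrow>
     e \<in> {1, -1} \<and> (0 < a \<and> even a \<or> ps = [] \<and> a = 1 \<and> e = 1) \<and> finite_ecf ps"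
  unfolding finite_ecf_def
  by (cases ps) (auto simp: All_less_Suc2 split: prod.splits)

text \<open>Every inner partial quotient is at least \<open>2\<close>, so the value of the tail, being larger
  than \<open>-1\<close>, leaves the denominator larger than \<open>1\<close>. The value \<open>1\<close> comes only from the
  final pair \<open>(1, 1)\<close>, and \<open>-1\<close> never occurs because a final \<open>1\<close> has numerator \<open>1\<close>.\<close>

lemma ecf_value_bounds:
  assumes "finite_ecf ps"
  shows "ecf_value ps \<in> \<rat> \<and> -1 < ecf_value ps \<and> ecf_value ps \<le> 1 \<and>
    (ps \<noteq> [] \<longrightarrow> 0 < of_int (fst (hd ps)) * ecf_value ps)"
  using assms
proof (induction ps)
  case Nil
  then show ?case by simp
next
  case (Cons p r)
  obtain e a where p: "p = (e, a)" by force
  have fin: "e \<in> {1, -1}" "0 < a \<and> even a \<or> r = [] \<and> a = 1 \<and> e = 1" "finite_ecf r"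
    using Cons.prems by (auto simp: p finite_ecf_Cons)
  have IH: "ecf_value r \<in> \<rat>" "-1 < ecf_value r"
    using Cons.IH[OF fin(3)] by auto
  show ?case
  proof (cases "0 < a \<and> even a")
    case True
    then have "2 \<le> a" by (auto elim!: evenE)
    then have "1 < real a + ecf_value r" using IH by linarith
    then show ?thesis using fin(1) IH
      by (auto simp: p field_simps intro!: Rats_divide Rats_add)
  next
    case False
    then have "r = []" "a = 1" "e = 1" using fin(2) by auto
    then show ?thesis by (simp add: p)
  qed
qed

text \<open>The first numerator carries the sign of the whole value: replacing it by \<open>1\<close>
  turns the tail of an expansion into an expansion of a point of the unit interval.\<close>

lemma ecf_expansion_exists_abs:
  assumes "finite_ecf ps"
  obtains ps' where "ecf_expansion \<bar>ecf_value ps\<bar> ps'" "ecf_sum ps' = ecf_sum ps"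
proof (cases ps)
  case Nil
  then show ?thesis using that[of "[]"] by (simp add: ecf_expansion_def finite_ecf_Nil)
next
  case (Cons p r)
  obtain e a where p: "p = (e, a)" by force
  have e: "e = 1 \<or> e = -1" using assms by (auto simp: Cons p finite_ecf_Cons)
  have "0 < of_int e * ecf_value ps" using ecf_value_bounds[OF assms] by (simp add: Cons p)
  with e have "\<bar>ecf_value ps\<bar> = ecf_value ((1, a) # r)"
    by (auto simp: Cons p)
  moreover have "finite_ecf ((1, a) # r)" using assms by (auto simp: Cons p finite_ecf_Cons)
  ultimately show ?thesis using that[of "(1, a) # r"] by (simp add: ecf_expansion_def Cons p)
qed

lemma Y_iff: "x \<in> Y n \<longleftrightarrow> (\<exists>ps. ecf_expansion x ps \<and> ecf_sum ps \<le> 2 * n + 1)"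
proof -
  have "x \<in> \<rat> \<inter> {0..1}" if "ecf_expansion x ps" for ps
  proof (cases "ps = []")
    case True
    then show ?thesis using that by (auto simp: ecf_expansion_def)
  next
    case False
    then show ?thesis using that ecf_value_bounds[of ps] by (auto simp: ecf_expansion_def)
  qed
  then show ?thesis unfolding Y_def by blast
qed

lemma Y_subset: "Y n \<subseteq> {0..1}"
  by (auto simp: Y_def)

lemma Y_memD: "y \<in> Y n \<Longrightarrow> 0 \<le> y \<and> y \<le> 1"
  using Y_subset by fastforce

lemma zero_in_Y [simp]: "0 \<in> Y n"
  unfolding Y_iff by (rule exI[of _ "[]"]) (simp add: ecf_expansion_def finite_ecf_Nil)

lemma one_in_Y [simp]: "1 \<in> Y n"
  unfolding Y_iff
  by (rule exI[of _ "[(1, 1)]"]) (simp add: ecf_expansion_def finite_ecf_Nil finite_ecf_Cons)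

lemma Y_0: "Y 0 = {0, 1}"
proof -
  have "x = 0 \<or> x = 1" if x: "ecf_expansion x ps" and s: "ecf_sum ps \<le> 1" for x ps
  proof (cases ps)
    case Nil
    then show ?thesis using x by (simp add: ecf_expansion_def)
  next
    case (Cons p r)
    then show ?thesis using x s by (cases p) (auto simp: ecf_expansion_def finite_ecf_Cons)
  qed
  note small = this
  have "Y 0 \<subseteq> {0, 1}"
  proof
    fix x
    assume "x \<in> Y 0"
    then obtain ps where "ecf_expansion x ps" "ecf_sum ps \<le> 1" by (auto simp: Y_iff)
    then show "x \<in> {0, 1}" using small by auto
  qed
  then show ?thesis using zero_in_Y one_in_Y by auto
qed

lemma ecf_tail_in_Y:
  assumes "finite_ecf ps" "ecf_sum ps \<le> 2 * n + 1"
  shows "\<bar>ecf_value ps\<bar> \<in> Y n"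
  using ecf_expansion_exists_abs[OF assms(1)] assms(2) unfolding Y_iff by metis

text \<open>The first partial quotient decides the branch: at least \<open>4\<close> means \<open>br_add\<close>, and \<open>2\<close> means
  \<open>br_plus\<close> or \<open>br_minus\<close> according to the sign of the tail. The expansion \<open>[(1, 1)]\<close> is the
  fixed point \<open>1\<close> of \<open>br_minus\<close>.\<close>

lemma Y_Suc_subset:
  assumes "x \<in> Y (Suc n)"
  shows "x \<in> br_add ` Y n \<union> br_plus ` Y n \<union> br_minus ` Y n"
proof -
  obtain ps where ps: "ecf_expansion x ps" "ecf_sum ps \<le> 2 * n + 3"
    using assms by (auto simp: Y_iff)
  show ?thesis
  proof (cases ps)
    case Nil
    then have "x = br_add 0" using ps by (simp add: ecf_expansion_def br_add_def)
    then show ?thesis by auto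
  next
    case (Cons p r)
    obtain a where p: "p = (1, a)" using ps by (cases p) (auto simp: ecf_expansion_def Cons)
    have x: "x = 1 / (real a + ecf_value r)" and r: "finite_ecf r"
      and a: "0 < a \<and> even a \<or> r = [] \<and> a = 1"
      using ps by (auto simp: ecf_expansion_def Cons p finite_ecf_Cons)
    note rb = ecf_value_bounds[OF r]
    consider "a = 1" "r = []" | "a = 2" | "a > 2" "even a"
      using a by (cases "a \<le> 2") (auto simp: le_Suc_eq numeral_2_eq_2)
    then show ?thesis
    proof cases
      case 1
      then have "x = br_minus 1" using x by (simp add: br_minus_def)
      then show ?thesis by auto
    next
      case 2
      then have "\<bar>ecf_value r\<bar> \<in> Y n"
        using ps r by (intro ecf_tail_in_Y) (auto simp: Cons p)
      moreover have "x = br_plus \<bar>ecf_value r\<bar> \<or> x = br_minus \<bar>ecf_value r\<bar>"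
        using x 2 by (auto simp: br_plus_def br_minus_def)
      ultimately show ?thesis by auto
    next
      case 3
      define b where "b = a - 2"
      have b: "0 < b" "even b" "a = b + 2" using 3 by (auto simp: b_def)
      then have "2 \<le> b" by (auto elim!: evenE)
      then have pos: "0 < real b + ecf_value r" using rb by linarith
      have "finite_ecf ((1, b) # r)" using r b by (simp add: finite_ecf_Cons)
      then have "1 / (real b + ecf_value r) \<in> Y n"
        unfolding Y_iff using ps b
        by (intro exI[of _ "(1, b) # r"]) (auto simp: ecf_expansion_def Cons p)
      moreover have "x = br_add (1 / (real b + ecf_value r))"
        using pos by (simp add: x br_add_def b field_simps)
      ultimately show ?thesis by auto
    qed
  qed
qed

text \<open>At \<open>1\<close> the digit operation would give the pair \<open>(1, 3)\<close>, which is not allowed; the value \<open>1/3\<close>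
  is reached as \<open>br_plus 1\<close> instead.\<close>

lemma br_add_in_Y_Suc:
  assumes "x \<in> Y n" "x \<noteq> 1"
  shows "br_add x \<in> Y (Suc n)"
proof -
  obtain ps where ps: "ecf_expansion x ps" "ecf_sum ps \<le> 2 * n + 1"
    using assms by (auto simp: Y_iff)
  show ?thesis
  proof (cases ps)
    case Nil
    then show ?thesis using ps by (auto simp: ecf_expansion_def br_add_def)
  next
    case (Cons p r)
    obtain a where p: "p = (1, a)" using ps by (cases p) (auto simp: ecf_expansion_def Cons)
    have x: "x = 1 / (real a + ecf_value r)" and r: "finite_ecf r"
      and a: "0 < a" "even a"
      using ps assms(2) by (auto simp: ecf_expansion_def Cons p finite_ecf_Cons)
    have "2 \<le> a" using a by (auto elim!: evenE)
    then have "0 < real a + ecf_value r" using ecf_value_bounds[OF r] by linarith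
    then have "br_add x = ecf_value ((1, a + 2) # r)"
      by (simp add: x br_add_def field_simps)
    then show ?thesis unfolding Y_iff using ps a r
      by (intro exI[of _ "(1, a + 2) # r"]) (auto simp: ecf_expansion_def Cons p finite_ecf_Cons)
  qed
qed

lemma br_plus_in_Y_Suc:
  assumes "x \<in> Y n"
  shows "br_plus x \<in> Y (Suc n)"
proof -
  obtain ps where ps: "ecf_expansion x ps" "ecf_sum ps \<le> 2 * n + 1"
    using assms by (auto simp: Y_iff)
  then show ?thesis unfolding Y_iff
    by (intro exI[of _ "(1, 2) # ps"]) (auto simp: ecf_expansion_def finite_ecf_Cons br_plus_def)
qed

text \<open>The first numerator of the old expansion becomes \<open>-1\<close>. This needs an even first partial
  quotient, which only the fixed point \<open>1\<close> lacks.\<close>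

lemma br_minus_in_Y_Suc:
  assumes "x \<in> Y n"
  shows "br_minus x \<in> Y (Suc n)"
proof (cases "x = 1")
  case True
  then show ?thesis by (simp add: br_minus_def)
next
  case False
  obtain ps where ps: "ecf_expansion x ps" "ecf_sum ps \<le> 2 * n + 1"
    using assms by (auto simp: Y_iff)
  show ?thesis
  proof (cases ps)
    case Nil
    then have "br_minus x = br_plus x" using ps
      by (simp add: ecf_expansion_def br_minus_def br_plus_def)
    then show ?thesis using br_plus_in_Y_Suc[OF assms] by simp
  next
    case (Cons p r)
    obtain a where p: "p = (1, a)" using ps by (cases p) (auto simp: ecf_expansion_def Cons)
    have "finite_ecf r" "0 < a" "even a" "x = 1 / (real a + ecf_value r)"
      using ps False by (auto simp: ecf_expansion_def Cons p finite_ecf_Cons)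
    then show ?thesis unfolding Y_iff using ps
      by (intro exI[of _ "(1, 2) # (-1, a) # r"])
         (auto simp: ecf_expansion_def Cons p finite_ecf_Cons br_minus_def)
  qed
qed

text \<open>Neighbouring branches share the endpoints \<open>1/3\<close> and \<open>1/2\<close>. Assigning them to the right-hand
  branch makes the union disjoint, as counting requires.\<close>

lemma Y_Suc:
  "Y (Suc n) = br_add ` (Y n - {1}) \<union> br_plus ` (Y n - {0}) \<union> br_minus ` Y n"
proof -
  have "br_add 1 = br_plus 1" "br_plus 0 = br_minus 0"
    by (simp_all add: br_add_def br_plus_def br_minus_def)
  moreover have "x \<in> br_add ` Y n \<union> br_plus ` Y n \<union> br_minus ` Y n" if "x \<in> Y (Suc n)" for x
    using Y_Suc_subset[OF that] .
  ultimately have "Y (Suc n) \<subseteq> br_add ` (Y n - {1}) \<union> br_plus ` (Y n - {0}) \<union> br_minus ` Y n"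
    using zero_in_Y[of n] one_in_Y[of n]
    by (smt (verit, del_insts) Un_iff image_iff insertE empty_iff Diff_iff subsetI)
  then show ?thesis
    using br_add_in_Y_Suc br_plus_in_Y_Suc br_minus_in_Y_Suc by blast
qed

lemma finite_Y [simp]: "finite (Y n)"
  by (induction n) (auto simp: Y_0 Y_Suc)

lemma br_less_iff:
  assumes "0 \<le> x" "x \<le> 1" "0 \<le> y" "y \<le> 1"
  shows "br_add x < br_add y \<longleftrightarrow> x < y" "br_plus x < br_plus y \<longleftrightarrow> y < x"
    "br_minus x < br_minus y \<longleftrightarrow> x < y"
  using assms by (auto simp: br_add_def br_plus_def br_minus_def field_simps)

lemma br_le_iff:
  assumes "0 \<le> x" "x \<le> 1" "0 \<le> y" "y \<le> 1"
  shows "br_add x \<le> br_add y \<longleftrightarrow> x \<le> y" "br_plus x \<le> br_plus y \<longleftrightarrow> y \<le> x"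
    "br_minus x \<le> br_minus y \<longleftrightarrow> x \<le> y"
  using br_less_iff[of y x] assms by (auto simp: not_less[symmetric])

lemma br_inj_on: "inj_on br_add {0..1}" "inj_on br_plus {0..1}" "inj_on br_minus {0..1}"
  by (rule inj_onI, metis br_less_iff atLeastAtMost_iff less_irrefl linorder_neqE)+

lemma br_bounds:
  assumes "0 \<le> x" "x \<le> 1"
  shows "0 \<le> br_add x" "br_add x \<le> 1/3" "x < 1 \<Longrightarrow> br_add x < 1/3"
    "1/3 \<le> br_plus x" "br_plus x \<le> 1/2" "0 < x \<Longrightarrow> br_plus x < 1/2"
    "1/2 \<le> br_minus x"
  using assms by (auto simp: br_add_def br_plus_def br_minus_def field_simps)

lemma br_cases:
  assumes "0 \<le> x" "x \<le> 1"
  obtains (add) u where "0 \<le> u" "u < 1" "x = br_add u"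
    | (plus) u where "0 < u" "u \<le> 1" "x = br_plus u"
    | (minus) u where "0 \<le> u" "u \<le> 1" "x = br_minus u"
proof -
  consider "x < 1/3" | "1/3 \<le> x" "x < 1/2" | "1/2 \<le> x" by linarith
  then show ?thesis
  proof cases
    case 1
    then have "1 + 2 * (x / (1 - 2 * x)) = 1 / (1 - 2 * x)"
      by (simp add: field_simps)
    then have "x = br_add (x / (1 - 2 * x))" using 1 by (simp add: br_add_def)
    moreover have "x / (1 - 2 * x) < 1" using 1 by (simp add: divide_less_eq)
    ultimately show ?thesis using assms(1) 1 by (intro add[of "x / (1 - 2 * x)"]) simp_all
  next
    case 2
    then have "2 < 1 / x" "1 / x \<le> 3" by (simp_all add: less_divide_eq divide_le_eq)
    then show ?thesis by (intro plus[of "1 / x - 2"]) (simp_all add: br_plus_def)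
  next
    case 3
    then have "1 \<le> 1 / x" "1 / x \<le> 2" using assms by (simp_all add: le_divide_eq divide_le_eq)
    then show ?thesis by (intro minus[of "2 - 1 / x"]) (simp_all add: br_minus_def)
  qed
qed

lemma br_Y_bounds:
  assumes "z \<in> Y n"
  shows "br_add z \<le> 1/3" "z \<noteq> 1 \<Longrightarrow> br_add z < 1/3"
    "1/3 \<le> br_plus z" "z \<noteq> 0 \<Longrightarrow> br_plus z < 1/2" "1/2 \<le> br_minus z"
proof -
  have z: "0 \<le> z" "z \<le> 1" using Y_memD[OF assms] by auto
  show "br_add z \<le> 1/3" "1/3 \<le> br_plus z" "1/2 \<le> br_minus z"
    using br_bounds[OF z] by auto
  show "br_add z < 1/3" if "z \<noteq> 1" using that z by (intro br_bounds(3)) auto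
  show "br_plus z < 1/2" if "z \<noteq> 0" using that z by (intro br_bounds(6)) auto
qed

section \<open>Counting points of the partitions\<close>

lemma card_Y_Suc_filter:
  "card {y \<in> Y (Suc n). P y} =
    card {z \<in> Y n. z \<noteq> 1 \<and> P (br_add z)} + card {z \<in> Y n. z \<noteq> 0 \<and> P (br_plus z)}
    + card {z \<in> Y n. P (br_minus z)}"
proof -
  let ?A = "{z \<in> Y n. z \<noteq> 1 \<and> P (br_add z)}"
  let ?B = "{z \<in> Y n. z \<noteq> 0 \<and> P (br_plus z)}"
  let ?C = "{z \<in> Y n. P (br_minus z)}"
  have eq: "{y \<in> Y (Suc n). P y} = br_add ` ?A \<union> br_plus ` ?B \<union> br_minus ` ?C"
    by (auto simp: Y_Suc)
  have inj: "inj_on br_add ?A" "inj_on br_plus ?B" "inj_on br_minus ?C"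
    using Y_subset[of n] by (blast intro: br_inj_on[THEN inj_on_subset])+
  have A: "y < 1/3" if "y \<in> br_add ` ?A" for y
    using that br_Y_bounds(2) by blast
  have B: "1/3 \<le> y \<and> y < 1/2" if "y \<in> br_plus ` ?B" for y
    using that br_Y_bounds(3,4) by blast
  have C: "1/2 \<le> y" if "y \<in> br_minus ` ?C" for y
    using that br_Y_bounds(5) by blast
  have AB: False if "y \<in> br_add ` ?A" "y \<in> br_plus ` ?B" for y
    using A[OF that(1)] B[OF that(2)] by linarith
  have AC: False if "y \<in> br_add ` ?A" "y \<in> br_minus ` ?C" for y
    using A[OF that(1)] C[OF that(2)] by linarith
  have BC: False if "y \<in> br_plus ` ?B" "y \<in> br_minus ` ?C" for y
    using B[OF that(1)] C[OF that(2)] by linarith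
  have "br_add ` ?A \<inter> br_plus ` ?B = {}"
    "(br_add ` ?A \<union> br_plus ` ?B) \<inter> br_minus ` ?C = {}"
    using AB AC BC by (simp_all only: disjoint_iff Un_iff) blast+
  then show ?thesis
    unfolding eq by (simp add: card_Un_disjoint card_image inj)
qed

lemma card_Y: "card (Y n) = 3 ^ n + 1"
proof (induction n)
  case (Suc n)
  have "{z \<in> Y n. z \<noteq> 1} = Y n - {1}" "{z \<in> Y n. z \<noteq> 0} = Y n - {0}" by auto
  then show ?case using card_Y_Suc_filter[of n "\<lambda>_. True"] Suc
    by (simp add: card_Diff_singleton)
qed (simp add: Y_0)

definition count_below :: "nat \<Rightarrow> real \<Rightarrow> nat" where
  "count_below n x = card {y \<in> Y n. y < x}"

text \<open>The branch \<open>br_plus\<close> reverses the order and so exchanges strict and weak inequalities;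
  the two counts are needed together to obtain closed recursions.\<close>

definition count_upto :: "nat \<Rightarrow> real \<Rightarrow> nat" where
  "count_upto n x = card {y \<in> Y n. y \<le> x}"

lemma card_Y_ne: "card {z \<in> Y n. z \<noteq> 1} = 3 ^ n" "card {z \<in> Y n. z \<noteq> 0} = 3 ^ n"
proof -
  have "{z \<in> Y n. z \<noteq> 1} = Y n - {1}" "{z \<in> Y n. z \<noteq> 0} = Y n - {0}" by auto
  then show "card {z \<in> Y n. z \<noteq> 1} = 3 ^ n" "card {z \<in> Y n. z \<noteq> 0} = 3 ^ n"
    by (simp_all add: card_Diff_singleton card_Y)
qed

lemma card_greater: "card {z \<in> Y n. x < z} + count_upto n x = 3 ^ n + 1"
proof -
  have "Y n = {z \<in> Y n. x < z} \<union> {z \<in> Y n. z \<le> x}" by auto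
  then have "card (Y n) = card {z \<in> Y n. x < z} + card {z \<in> Y n. z \<le> x}"
    by (metis (no_types, lifting) card_Un_disjoint disjoint_iff finite_Un finite_Y mem_Collect_eq not_le)
  then show ?thesis by (simp add: card_Y count_upto_def)
qed

lemma card_at_least: "card {z \<in> Y n. x \<le> z} + count_below n x = 3 ^ n + 1"
proof -
  have "Y n = {z \<in> Y n. x \<le> z} \<union> {z \<in> Y n. z < x}" by auto
  then have "card (Y n) = card {z \<in> Y n. x \<le> z} + card {z \<in> Y n. z < x}"
    by (metis (no_types, lifting) card_Un_disjoint disjoint_iff finite_Un finite_Y mem_Collect_eq not_le)
  then show ?thesis by (simp add: card_Y count_below_def)
qed

lemma below_le_upto: "count_below n x \<le> count_upto n x"
  unfolding count_below_def count_upto_def by (rule card_mono) auto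

lemma upto_le_Suc_below: "count_upto n x \<le> Suc (count_below n x)"
proof -
  have "{y \<in> Y n. y \<le> x} \<subseteq> insert x {y \<in> Y n. y < x}" by auto
  then have "count_upto n x \<le> card (insert x {y \<in> Y n. y < x})"
    unfolding count_upto_def by (rule card_mono[rotated]) simp
  also have "\<dots> \<le> Suc (count_below n x)" by (simp add: count_below_def card_insert_if)
  finally show ?thesis .
qed

lemma below_0: "count_below n 0 = 0"
proof -
  have "{y \<in> Y n. y < 0} = {}" using Y_memD[of _ n] by (auto simp: not_less)
  then show ?thesis by (simp add: count_below_def)
qed

lemma upto_1: "count_upto n 1 = 3 ^ n + 1"
proof -
  have "{y \<in> Y n. y \<le> 1} = Y n" using Y_memD by blast
  then show ?thesis by (simp add: count_upto_def card_Y)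
qed

lemma below_le:
  assumes "x \<le> 1"
  shows "count_below n x \<le> 3 ^ n"
proof -
  have "count_below n x \<le> card {z \<in> Y n. z \<noteq> 1}"
    unfolding count_below_def using assms by (intro card_mono) auto
  then show ?thesis by (simp add: card_Y_ne)
qed

lemma below_1: "count_below n 1 = 3 ^ n"
proof (rule antisym)
  show "count_below n 1 \<le> 3 ^ n" by (rule below_le) simp
  show "3 ^ n \<le> count_below n 1" using upto_le_Suc_below[of n 1] unfolding upto_1 by linarith
qed

lemma upto_le:
  assumes "x < 1"
  shows "count_upto n x \<le> 3 ^ n"
proof -
  have "count_upto n x \<le> card {z \<in> Y n. z \<noteq> 1}"
    unfolding count_upto_def using assms by (intro card_mono) auto
  then show ?thesis by (simp add: card_Y_ne)
qed

lemma below_pos: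
  assumes "0 < x"
  shows "0 < count_below n x"
proof -
  have "0 \<in> {y \<in> Y n. y < x}" using assms by simp
  then show ?thesis unfolding count_below_def card_gt_0_iff
    by (metis empty_iff finite_Collect_conjI finite_Y Collect_mem_eq)
qed

lemma upto_pos:
  assumes "0 \<le> x"
  shows "0 < count_upto n x"
proof -
  have "0 \<in> {y \<in> Y n. y \<le> x}" using assms by simp
  then show ?thesis unfolding count_upto_def card_gt_0_iff
    by (metis empty_iff finite_Collect_conjI finite_Y Collect_mem_eq)
qed

lemma below_br_add:
  assumes "0 \<le> u" "u \<le> 1"
  shows "count_below (Suc n) (br_add u) = count_below n u"
proof -
  have "\<not> br_plus z < br_add u" "\<not> br_minus z < br_add u" if "z \<in> Y n" for z
    using br_bounds(2)[OF assms] br_Y_bounds(3,5)[OF that] by linarith+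
  then have "{z \<in> Y n. z \<noteq> 0 \<and> br_plus z < br_add u} = {}" "{z \<in> Y n. br_minus z < br_add u} = {}"
    by blast+
  moreover have "{z \<in> Y n. z \<noteq> 1 \<and> br_add z < br_add u} = {z \<in> Y n. z < u}"
    using assms by (auto simp: br_less_iff dest: Y_memD)
  ultimately show ?thesis by (simp only: count_below_def card_Y_Suc_filter) simp
qed

lemma upto_br_add:
  assumes "0 \<le> u" "u < 1"
  shows "count_upto (Suc n) (br_add u) = count_upto n u"
proof -
  have u: "br_add u < 1/3" using assms br_bounds(3)[of u] by simp
  have "\<not> br_plus z \<le> br_add u" "\<not> br_minus z \<le> br_add u" if "z \<in> Y n" for z
    using u br_Y_bounds(3,5)[OF that] by linarith+
  then have "{z \<in> Y n. z \<noteq> 0 \<and> br_plus z \<le> br_add u} = {}" "{z \<in> Y n. br_minus z \<le> br_add u} = {}"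
    by blast+
  moreover have "{z \<in> Y n. z \<noteq> 1 \<and> br_add z \<le> br_add u} = {z \<in> Y n. z \<le> u}"
    using assms by (auto simp: br_le_iff dest: Y_memD)
  ultimately show ?thesis by (simp only: count_upto_def card_Y_Suc_filter) simp
qed

lemma below_br_plus:
  assumes "0 \<le> u" "u \<le> 1"
  shows "count_below (Suc n) (br_plus u) + count_upto n u = 2 * 3 ^ n + 1"
proof -
  have "br_add z < br_plus u" if "z \<in> Y n" "z \<noteq> 1" for z
    using br_Y_bounds(2)[OF that] br_bounds(4)[OF assms] by linarith
  then have "{z \<in> Y n. z \<noteq> 1 \<and> br_add z < br_plus u} = {z \<in> Y n. z \<noteq> 1}" by blast
  moreover have "{z \<in> Y n. z \<noteq> 0 \<and> br_plus z < br_plus u} = {z \<in> Y n. u < z}"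
    using assms by (auto simp: br_less_iff dest: Y_memD)
  moreover have "\<not> br_minus z < br_plus u" if "z \<in> Y n" for z
    using br_bounds(5)[OF assms] br_Y_bounds(5)[OF that] by linarith
  then have "{z \<in> Y n. br_minus z < br_plus u} = {}" by blast
  ultimately show ?thesis using card_greater[of n u]
    by (simp only: count_below_def card_Y_Suc_filter card_Y_ne) simp
qed

lemma upto_br_plus:
  assumes "0 < u" "u \<le> 1"
  shows "count_upto (Suc n) (br_plus u) + count_below n u = 2 * 3 ^ n + 1"
proof -
  have u: "1/3 \<le> br_plus u" "br_plus u < 1/2"
    using assms br_bounds(4,6)[of u] by simp_all
  have "br_add z \<le> br_plus u" if "z \<in> Y n" for z
    using br_Y_bounds(1)[OF that] u by linarith
  then have "{z \<in> Y n. z \<noteq> 1 \<and> br_add z \<le> br_plus u} = {z \<in> Y n. z \<noteq> 1}" by blast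
  moreover have "{z \<in> Y n. z \<noteq> 0 \<and> br_plus z \<le> br_plus u} = {z \<in> Y n. u \<le> z}"
    using assms by (auto simp: br_le_iff dest: Y_memD)
  moreover have "\<not> br_minus z \<le> br_plus u" if "z \<in> Y n" for z
    using u br_Y_bounds(5)[OF that] by linarith
  then have "{z \<in> Y n. br_minus z \<le> br_plus u} = {}" by blast
  ultimately show ?thesis using card_at_least[of n u]
    by (simp only: count_upto_def card_Y_Suc_filter card_Y_ne) simp
qed

lemma count_br_minus:
  assumes "0 \<le> u" "u \<le> 1"
  shows below_br_minus: "count_below (Suc n) (br_minus u) = 2 * 3 ^ n + count_below n u"
    and upto_br_minus: "count_upto (Suc n) (br_minus u) = 2 * 3 ^ n + count_upto n u"
proof -
  have d: "br_add z < br_minus u" "z \<noteq> 0 \<Longrightarrow> br_plus z < br_minus u" if "z \<in> Y n" for z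
    using br_Y_bounds(1,4)[OF that] br_bounds(7)[OF assms] by linarith+
  then have "{z \<in> Y n. z \<noteq> 1 \<and> br_add z < br_minus u} = {z \<in> Y n. z \<noteq> 1}"
    "{z \<in> Y n. z \<noteq> 1 \<and> br_add z \<le> br_minus u} = {z \<in> Y n. z \<noteq> 1}"
    "{z \<in> Y n. z \<noteq> 0 \<and> br_plus z < br_minus u} = {z \<in> Y n. z \<noteq> 0}"
    "{z \<in> Y n. z \<noteq> 0 \<and> br_plus z \<le> br_minus u} = {z \<in> Y n. z \<noteq> 0}"
    by (blast intro: less_imp_le)+
  moreover have "{z \<in> Y n. br_minus z < br_minus u} = {z \<in> Y n. z < u}"
    "{z \<in> Y n. br_minus z \<le> br_minus u} = {z \<in> Y n. z \<le> u}"
    using assms by (auto simp: br_less_iff br_le_iff dest: Y_memD)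
  ultimately show "count_below (Suc n) (br_minus u) = 2 * 3 ^ n + count_below n u"
    "count_upto (Suc n) (br_minus u) = 2 * 3 ^ n + count_upto n u"
    by (simp_all only: count_below_def count_upto_def card_Y_Suc_filter card_Y_ne)
qed

text \<open>This is the statement that every interval between neighbours in \<open>Y n\<close> is cut into three by
  \<open>Y (Suc n)\<close>, read off from the position of \<open>x\<close>. The branch recursions are affine with the
  scale \<open>3\<^sup>n\<close>, so they carry the inequalities from one level to the next; on the
  middle branch those for one count follow from those for the other.\<close>

lemma count_refine:
  assumes "0 \<le> x" "x \<le> 1"
  shows "count_below (Suc n) x \<le> 3 * count_below n x \<and> 3 * count_below n x \<le> count_below (Suc n) x + 2 \<and>
    count_upto (Suc n) x \<le> 3 * count_upto n x \<and> 3 * count_upto n x \<le> count_upto (Suc n) x + 2"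
  using assms
proof (induction n arbitrary: x)
  case 0
  have "count_below (Suc 0) x \<le> 3 * count_below 0 x \<and> 3 * count_below 0 x \<le> count_below (Suc 0) x + 2"
  proof (cases "x = 0")
    case False
    then show ?thesis
      using 0 below_pos[of x 0] below_pos[of x "Suc 0"] below_le[of x 0] below_le[of x "Suc 0"] by simp
  qed (simp add: below_0)
  moreover have "count_upto (Suc 0) x \<le> 3 * count_upto 0 x \<and> 3 * count_upto 0 x \<le> count_upto (Suc 0) x + 2"
  proof (cases "x = 1")
    case False
    then show ?thesis
      using 0 upto_pos[of x 0] upto_pos[of x "Suc 0"] upto_le[of x 0] upto_le[of x "Suc 0"] by simp
  qed (simp add: upto_1)
  ultimately show ?case by blast
next
  case (Suc n)
  from Suc.prems show ?case
  proof (cases x rule: br_cases)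
    case (add u)
    then show ?thesis using Suc.IH[of u] by (simp add: below_br_add upto_br_add)
  next
    case (plus u)
    then show ?thesis
      using Suc.IH[of u] below_br_plus[of u n] below_br_plus[of u "Suc n"]
        upto_br_plus[of u n] upto_br_plus[of u "Suc n"] by simp
  next
    case (minus u)
    then show ?thesis using Suc.IH[of u] by (simp add: count_br_minus)
  qed
qed

section \<open>The limit and its basic properties\<close>

lemma decseq_count_below:
  assumes "0 \<le> x" "x \<le> 1"
  shows "decseq (\<lambda>n. real (count_below n x) / 3 ^ n)"
proof (rule decseq_SucI)
  fix n
  have "real (count_below (Suc n) x) \<le> 3 * real (count_below n x)"
    using count_refine[OF assms, of n] by linarith
  then have "real (count_below (Suc n) x) / 3 ^ Suc n \<le> 3 * real (count_below n x) / 3 ^ Suc n"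
    by (intro divide_right_mono) auto
  then show "real (count_below (Suc n) x) / 3 ^ Suc n \<le> real (count_below n x) / 3 ^ n" by simp
qed

lemma incseq_count_below:
  assumes "0 \<le> x" "x \<le> 1"
  shows "incseq (\<lambda>n. (real (count_below n x) - 1) / 3 ^ n)"
proof (rule incseq_SucI)
  fix n
  have "3 * count_below n x \<le> count_below (Suc n) x + 2"
    using count_refine[OF assms, of n] by blast
  then have "real (3 * count_below n x) \<le> real (count_below (Suc n) x + 2)"
    by (simp only: of_nat_le_iff)
  then have "3 * (real (count_below n x) - 1) \<le> real (count_below (Suc n) x) - 1"
    by simp
  then have "3 * (real (count_below n x) - 1) / 3 ^ Suc n \<le> (real (count_below (Suc n) x) - 1) / 3 ^ Suc n"
    by (intro divide_right_mono) auto
  moreover have "a / 3 ^ n = 3 * a / 3 ^ Suc n" for a :: real by simp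
  ultimately show "(real (count_below n x) - 1) / 3 ^ n \<le> (real (count_below (Suc n) x) - 1) / 3 ^ Suc n"
    by (simp only:)
qed

lemma Q_E_limit:
  assumes "0 \<le> x" "x \<le> 1"
  shows "(\<lambda>n. real (count_below n x) / 3 ^ n) \<longlonglongrightarrow> Q_E x"
proof -
  have "\<bar>real (count_below n x) / 3 ^ n\<bar> \<le> 1" for n
    using below_le[OF assms(2), of n] by (simp add: divide_le_eq flip: of_nat_power)
  then have "convergent (\<lambda>n. real (count_below n x) / 3 ^ n)"
    by (intro Bseq_monoseq_convergent BseqI'[of _ 1] decseq_imp_monoseq decseq_count_below assms) simp
  then show ?thesis unfolding Q_E_def count_below_def convergent_LIMSEQ_iff .
qed

lemma Q_E_le:
  assumes "0 \<le> x" "x \<le> 1"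
  shows "Q_E x \<le> real (count_below n x) / 3 ^ n"
  by (rule decseq_ge[OF decseq_count_below Q_E_limit]) (use assms in auto)

lemma Q_E_ge:
  assumes "0 \<le> x" "x \<le> 1"
  shows "(real (count_below n x) - 1) / 3 ^ n \<le> Q_E x"
proof (rule incseq_le[OF incseq_count_below[OF assms]])
  have "(\<lambda>n. real (count_below n x) / 3 ^ n - (1 / 3) ^ n) \<longlonglongrightarrow> Q_E x - 0"
    by (intro tendsto_diff Q_E_limit assms LIMSEQ_power_zero) simp
  then show "(\<lambda>n. (real (count_below n x) - 1) / 3 ^ n) \<longlonglongrightarrow> Q_E x"
    by (simp add: diff_divide_distrib power_one_over)
qed

lemma Q_E_range:
  assumes "0 \<le> x" "x \<le> 1"
  shows "0 \<le> Q_E x" "Q_E x \<le> 1"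
proof -
  show "0 \<le> Q_E x" by (rule LIMSEQ_le_const[OF Q_E_limit[OF assms]]) simp
  show "Q_E x \<le> 1" using Q_E_le[OF assms, of 0] below_le[of x 0] assms by simp
qed

lemma Q_E_0: "Q_E 0 = 0"
  using Q_E_le[of 0 0] Q_E_range[of 0] by (simp add: below_0)

lemma Q_E_1: "Q_E 1 = 1"
  using Q_E_limit[of 1] LIMSEQ_unique[OF _ tendsto_const[of 1]] by (simp add: below_1)

lemma Q_E_mono:
  assumes "0 \<le> x" "x \<le> y" "y \<le> 1"
  shows "Q_E x \<le> Q_E y"
proof -
  have "count_below n x \<le> count_below n y" for n
    unfolding count_below_def using assms by (intro card_mono) auto
  then have "real (count_below n x) / 3 ^ n \<le> real (count_below n y) / 3 ^ n" for n
    by (simp add: divide_right_mono)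
  then show ?thesis
    using assms by (intro LIMSEQ_le[OF Q_E_limit[of x] Q_E_limit[of y]]) auto
qed

text \<open>The middle branch reverses the order, so this functional equation relates the strict
  count at one point to the weak count at the other; the two differ by at most \<open>1\<close>, which is
  invisible in the limit.\<close>

lemma Q_E_br_plus:
  assumes "0 \<le> x" "x \<le> 1"
  shows "Q_E (br_plus x) = 2 / 3 - Q_E x / 3"
proof -
  have z: "(\<lambda>n. (1 / 3 :: real) ^ n) \<longlonglongrightarrow> 0" by (rule LIMSEQ_power_zero) simp
  have up: "(\<lambda>n. real (count_upto n x) / 3 ^ n) \<longlonglongrightarrow> Q_E x"
  proof (rule tendsto_sandwich[OF _ _ Q_E_limit[OF assms]])
    show "\<forall>\<^sub>F n in sequentially. real (count_below n x) / 3 ^ n \<le> real (count_upto n x) / 3 ^ n"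
      using below_le_upto by (simp add: divide_right_mono)
    have "real (count_upto n x) / 3 ^ n \<le> real (count_below n x) / 3 ^ n + (1 / 3) ^ n" for n
      using upto_le_Suc_below[of n x] by (simp add: power_one_over field_simps)
    then show "\<forall>\<^sub>F n in sequentially. real (count_upto n x) / 3 ^ n \<le> real (count_below n x) / 3 ^ n + (1 / 3) ^ n"
      by simp
    show "(\<lambda>n. real (count_below n x) / 3 ^ n + (1 / 3) ^ n) \<longlonglongrightarrow> Q_E x"
      using tendsto_add[OF Q_E_limit[OF assms] z] by simp
  qed
  have "real (count_below (Suc n) (br_plus x)) / 3 ^ Suc n =
      2 / 3 + (1 / 3) ^ n / 3 - real (count_upto n x) / 3 ^ n / 3" for n
  proof -
    have "real (count_below (Suc n) (br_plus x)) + real (count_upto n x) = 2 * 3 ^ n + 1"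
      using below_br_plus[OF assms, of n] by (metis of_nat_1 of_nat_add of_nat_mult of_nat_numeral of_nat_power)
    then have "real (count_below (Suc n) (br_plus x)) = 2 * 3 ^ n + 1 - real (count_upto n x)"
      by linarith
    then show ?thesis by (simp add: power_one_over diff_divide_distrib add_divide_distrib)
  qed
  moreover have "(\<lambda>n. 2 / 3 + (1 / 3) ^ n / 3 - real (count_upto n x) / 3 ^ n / 3)
      \<longlonglongrightarrow> 2 / 3 + 0 / 3 - Q_E x / 3"
    by (intro tendsto_intros z up) auto
  moreover have "(\<lambda>n. real (count_below (Suc n) (br_plus x)) / 3 ^ Suc n) \<longlonglongrightarrow> Q_E (br_plus x)"
    using br_bounds(4,5)[OF assms] by (intro LIMSEQ_Suc Q_E_limit) auto
  ultimately show ?thesis using LIMSEQ_unique by fastforce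
qed

section \<open>Separation of the points and the Hoelder bound\<close>

abbreviation (input) silver :: real where "silver \<equiv> 1 + sqrt 2"

lemma silver_square: "silver * silver = 1 + 2 * silver"
  by (simp add: algebra_simps)

text \<open>The form \<open>p + silver * q\<close> is an eigenvector, with eigenvalue \<open>silver\<close>, of the action
  \<open>(p, q) \<mapsto> (q, 2q + p)\<close> of the middle branch on fractions. The outer branches increase it by at
  most the same factor, because the fractions lie in the unit interval.\<close>

lemma Y_denominator:
  assumes "y \<in> Y n"
  obtains p q :: int where "y = p / q" "0 < q" "0 \<le> p" "p \<le> q"
    "p + silver * q \<le> (1 + silver) * silver ^ n"
proof -
  have "\<exists>(p :: int) (q :: int). y = real_of_int p / real_of_int q \<and> 0 < q \<and> 0 \<le> p \<and> p \<le> q \<and>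
    real_of_int p + silver * real_of_int q \<le> (1 + silver) * silver ^ n"
    using assms
  proof (induction n arbitrary: y)
    case 0
    then consider "y = 0" | "y = 1" by (auto simp: Y_0)
    then show ?case
    proof cases
      case 1
      then show ?thesis by (intro exI[of _ 0] exI[of _ 1]) simp
    next
      case 2
      then show ?thesis by (intro exI[of _ 1]) simp
    qed
  next
    case (Suc n)
    from Suc.prems obtain z where z: "z \<in> Y n" "y = br_add z \<or> y = br_plus z \<or> y = br_minus z"
      by (auto simp: Y_Suc)
    from Suc.IH[OF z(1)] obtain p q :: int where
      pq: "z = p / q" "0 < q" "0 \<le> p" "p \<le> q" "p + silver * q \<le> (1 + silver) * silver ^ n"
      by blast
    have bound: "silver * (p + silver * q) \<le> (1 + silver) * silver ^ Suc n"
      using mult_left_mono[OF pq(5), of silver] by (simp add: mult_ac)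
    have expand: "silver * (p + silver * q) = silver * p + (1 + 2 * silver) * q"
      by (simp add: algebra_simps)
    have real_pq: "0 < real_of_int q" "0 \<le> real_of_int p" "real_of_int p \<le> real_of_int q"
      using pq by auto
    from z(2) consider "y = br_add z" | "y = br_plus z" | "y = br_minus z" by blast
    then show ?case
    proof cases
      case 1
      have "y = p / (q + 2 * p)" using real_pq by (simp add: 1 pq(1) br_add_def field_simps)
      moreover have "p + silver * (q + 2 * p) \<le> silver * (p + silver * q)"
      proof -
        have "silver * (p + silver * q) - (p + silver * (q + 2 * p)) = (2 + sqrt 2) * (q - p)"
          unfolding expand by (simp add: algebra_simps)
        moreover have "0 \<le> (2 + sqrt 2) * (q - p)"
          using real_pq by (intro mult_nonneg_nonneg) simp_all
        ultimately show ?thesis by linarith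
      qed
      ultimately show ?thesis using pq bound
        by (intro exI[of _ p] exI[of _ "q + 2 * p"]) auto
    next
      case 2
      have "y = q / (2 * q + p)" using real_pq by (simp add: 2 pq(1) br_plus_def field_simps)
      moreover have "q + silver * (2 * q + p) = silver * (p + silver * q)"
        unfolding expand by (simp add: algebra_simps)
      ultimately show ?thesis using pq bound
        by (intro exI[of _ q] exI[of _ "2 * q + p"]) auto
    next
      case 3
      have "y = q / (2 * q - p)" using real_pq by (simp add: 3 pq(1) br_minus_def field_simps)
      moreover have "q + silver * (2 * q - p) \<le> silver * (p + silver * q)"
      proof -
        have "silver * (p + silver * q) - (q + silver * (2 * q - p)) = 2 * silver * p"
          unfolding expand by (simp add: algebra_simps)
        moreover have "0 \<le> 2 * silver * p"
          using real_pq by (intro mult_nonneg_nonneg) simp_all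
        ultimately show ?thesis by linarith
      qed
      ultimately show ?thesis using pq bound
        by (intro exI[of _ q] exI[of _ "2 * q - p"]) auto
    qed
  qed
  then show ?thesis using that by blast
qed

lemma Y_denominator_le:
  assumes "y \<in> Y n"
  obtains p q :: int where "y = p / q" "0 < q" "q \<le> silver ^ Suc n"
proof -
  obtain p q :: int where pq: "y = p / q" "0 < q" "0 \<le> p"
    "p + silver * q \<le> (1 + silver) * silver ^ n"
    using Y_denominator[OF assms] by metis
  have "silver * q \<le> (1 + silver) * silver ^ n" using pq by simp
  also have "\<dots> \<le> silver * silver ^ Suc n"
    using silver_square by (simp add: mult_right_mono flip: mult.assoc)
  finally have "q \<le> silver ^ Suc n" by (simp add: mult_le_cancel_left_pos add_pos_pos)
  then show ?thesis using pq that by blast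
qed

text \<open>Two distinct fractions differ by at least the reciprocal of the product of their
  denominators.\<close>

lemma Y_separated:
  assumes "y \<in> Y n" "z \<in> Y n" "y < z"
  shows "1 / (silver ^ 2) ^ Suc n \<le> z - y"
proof -
  obtain p q :: int where pq: "y = p / q" "0 < q" "q \<le> silver ^ Suc n"
    using Y_denominator_le[OF assms(1)] by metis
  obtain r s :: int where rs: "z = r / s" "0 < s" "s \<le> silver ^ Suc n"
    using Y_denominator_le[OF assms(2)] by metis
  have diff: "z - y = (r * q - p * s) / (q * s)"
    using pq(1,2) rs(1,2) by (simp add: diff_frac_eq mult.commute)
  have "real_of_int (p * s) < real_of_int (r * q)"
    using assms(3) pq rs by (simp add: field_simps)
  then have "1 \<le> r * q - p * s" by linarith
  then have num: "1 \<le> real_of_int (r * q - p * s)" by linarith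
  have "real_of_int (q * s) \<le> silver ^ Suc n * silver ^ Suc n"
    using mult_mono[OF pq(3) rs(3)] pq rs by simp
  also have "\<dots> = (silver ^ 2) ^ Suc n"
    by (simp only: power_mult[symmetric] power_add[symmetric] mult_2)
  finally have den: "real_of_int (q * s) \<le> (silver ^ 2) ^ Suc n" .
  have "1 / (silver ^ 2) ^ Suc n \<le> real_of_int (r * q - p * s) / real_of_int (q * s)"
    using num den pq rs by (intro frac_le) auto
  then show ?thesis using diff by simp
qed

text \<open>So close together, \<open>x\<close> and \<open>y\<close> have at most one point of \<open>Y n\<close> between them, so their counts
  differ by at most \<open>1\<close>; the second \<open>1 / 3 ^ n\<close> pays for replacing the limit by its
  approximation at level \<open>n\<close>.\<close>

lemma Q_E_diff_le:
  assumes "0 \<le> x" "x \<le> y" "y \<le> 1" "y - x < 1 / (silver ^ 2) ^ Suc n"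
  shows "Q_E y - Q_E x \<le> 2 / 3 ^ n"
proof -
  let ?S = "{z \<in> Y n. x \<le> z \<and> z < y}"
  have "u = v" if "u \<in> ?S" "v \<in> ?S" for u v
    using that Y_separated[of u n v] Y_separated[of v n u] assms(4)
    by (cases u v rule: linorder_cases) auto
  then have one: "card ?S \<le> 1" by (simp add: card_le_Suc0_iff_eq)
  have "{z \<in> Y n. z < y} \<subseteq> {z \<in> Y n. z < x} \<union> ?S" by auto
  then have "count_below n y \<le> card ({z \<in> Y n. z < x} \<union> ?S)"
    unfolding count_below_def by (rule card_mono[rotated]) simp
  also have "\<dots> \<le> count_below n x + card ?S"
    unfolding count_below_def by (rule card_Un_le)
  finally have "real (count_below n y) \<le> real (count_below n x) + 1" using one by linarith
  then have "Q_E y \<le> (real (count_below n x) + 1) / 3 ^ n"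
    using Q_E_le[of y n] assms by (meson divide_right_mono order_trans zero_le_numeral zero_le_power)
  moreover have "(real (count_below n x) - 1) / 3 ^ n \<le> Q_E x" using Q_E_ge[of x n] assms by simp
  ultimately show ?thesis by (simp add: diff_divide_distrib add_divide_distrib)
qed

text \<open>The length \<open>y - x\<close> is placed between two consecutive powers of \<open>1 / silver\<^sup>2\<close>, whose
  \<open>\<alpha>\<close>-th powers are powers of \<open>1/3\<close>. The constant is \<open>18 = 2 * 3\<^sup>2\<close>: a factor \<open>3\<close> for the upper
  instead of the lower of the two powers, and another because \<open>Q_E_diff_le\<close> bounds the length
  by the power with exponent \<open>n + 1\<close>.\<close>

lemma Q_E_holder_estimate:
  assumes \<alpha>: "\<alpha> > 0" "(silver ^ 2) powr \<alpha> = 3" and xy: "0 \<le> x" "x < y" "y \<le> 1"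
  shows "Q_E y - Q_E x \<le> 18 * (y - x) powr \<alpha>"
proof -
  define l where "l = silver ^ 2"
  have l: "1 < l" by (simp add: l_def one_less_power)
  have "(1 / l ^ k) powr \<alpha> = 1 / 3 ^ k" for k
    using l \<alpha>(2) by (simp add: powr_divide powr_power powr_realpow[symmetric] powr_powr l_def[symmetric] mult.commute)
       (simp add: powr_powr[symmetric] powr_realpow)
  note scale = this
  have "\<exists>k. 1 / l ^ Suc k \<le> y - x"
  proof -
    obtain k where "1 / (y - x) < l ^ k" using real_arch_pow[OF l] by blast
    also have "l ^ k \<le> l ^ Suc k" using l by (intro power_increasing) auto
    finally show ?thesis using xy l by (intro exI[of _ k]) (simp add: field_simps)
  qed
  \<comment> \<open>The least such \<open>k\<close> gives both bounds; \<open>k = 0\<close> leaves only the lower one, and there the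
    trivial bound \<open>1\<close> on the difference of values is enough.\<close>
  then obtain k where k: "1 / l ^ Suc k \<le> y - x" "\<And>j. j < k \<Longrightarrow> y - x < 1 / l ^ Suc j"
    using exists_least_iff[of "\<lambda>k. 1 / l ^ Suc k \<le> y - x"] by (auto simp: not_le)
  have "(1 / l ^ Suc k) powr \<alpha> \<le> (y - x) powr \<alpha>"
    using k(1) \<alpha>(1) l by (intro powr_mono2) auto
  then have lower: "1 / 3 ^ Suc k \<le> (y - x) powr \<alpha>" by (simp only: scale)
  show ?thesis
  proof (cases k)
    case 0
    then show ?thesis
      using lower Q_E_range(2)[of y] Q_E_range(1)[of x] xy by simp
  next
    case (Suc n)
    then have "Q_E y - Q_E x \<le> 2 / 3 ^ n"
      using xy k(2)[of n] by (intro Q_E_diff_le) (auto simp: l_def)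
    also have "\<dots> = 18 * (1 / 3 ^ Suc k)" using Suc by simp
    finally show ?thesis using lower by linarith
  qed
qed

section \<open>Optimality of the exponent\<close>

lemma br_plus_fraction:
  assumes "0 < q"
  shows "br_plus (p / q) = q / (2 * q + p)"
proof -
  have "2 + p / q = (2 * q + p) / q" using assms by (simp add: field_simps)
  then show ?thesis by (simp add: br_plus_def)
qed

lemma br_plus_iterate_unit: "0 \<le> (br_plus ^^ n) x \<and> (br_plus ^^ n) x \<le> 1" if "0 \<le> x" "x \<le> 1"
proof (induction n)
  case (Suc n)
  then show ?case using br_bounds(4,5)[of "(br_plus ^^ n) x"] by simp
qed (use that in simp)

lemma Q_E_br_plus_iterate:
  "\<bar>Q_E ((br_plus ^^ n) 1) - Q_E ((br_plus ^^ n) 0)\<bar> = 1 / 3 ^ n"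
proof (induction n)
  case (Suc n)
  have "Q_E (br_plus ((br_plus ^^ n) 1)) - Q_E (br_plus ((br_plus ^^ n) 0)) =
      (Q_E ((br_plus ^^ n) 0) - Q_E ((br_plus ^^ n) 1)) / 3"
    using br_plus_iterate_unit[of 0 n] br_plus_iterate_unit[of 1 n]
    by (simp add: Q_E_br_plus field_simps)
  then show ?case using Suc by (simp add: abs_minus_commute)
qed (simp add: Q_E_0 Q_E_1)

text \<open>The matrix of the middle branch has determinant \<open>-1\<close>, so the two fractions stay Farey
  neighbours and their distance is the reciprocal of the product of the denominators. The exact
  growth of the eigenform shows that this product is as large as possible up to a constant factor.\<close>

lemma br_plus_iterate_fractions:
  "\<exists>p q r s :: real. (br_plus ^^ n) 0 = p / q \<and> (br_plus ^^ n) 1 = r / s \<and>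
    0 \<le> p \<and> p \<le> q \<and> 0 < q \<and> 0 \<le> r \<and> r \<le> s \<and> 0 < s \<and> \<bar>r * q - p * s\<bar> = 1 \<and>
    p + silver * q = silver ^ Suc n \<and> r + silver * s = (1 + silver) * silver ^ n"
proof (induction n)
  case 0
  show ?case by (rule exI[of _ 0], rule exI[of _ 1], rule exI[of _ 1], rule exI[of _ 1]) simp
next
  case (Suc n)
  then obtain p q r s :: real where h: "(br_plus ^^ n) 0 = p / q" "(br_plus ^^ n) 1 = r / s"
    "0 \<le> p" "p \<le> q" "0 < q" "0 \<le> r" "r \<le> s" "0 < s" "\<bar>r * q - p * s\<bar> = 1"
    "p + silver * q = silver ^ Suc n" "r + silver * s = (1 + silver) * silver ^ n"
    by blast
  have step: "v + silver * (2 * v + u) = silver * (u + silver * v)" for u v :: real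
    by (simp add: algebra_simps)
  have "(br_plus ^^ Suc n) 0 = q / (2 * q + p)" "(br_plus ^^ Suc n) 1 = s / (2 * s + r)"
    using h(1,2,5,8) by (simp_all add: br_plus_fraction)
  moreover have "s * (2 * q + p) - q * (2 * s + r) = - (r * q - p * s)" by algebra
  then have "\<bar>s * (2 * q + p) - q * (2 * s + r)\<bar> = 1" using h(9) by linarith
  moreover have "q + silver * (2 * q + p) = silver ^ Suc (Suc n)"
    "s + silver * (2 * s + r) = (1 + silver) * silver ^ Suc n"
    unfolding step h(10,11) by simp_all
  ultimately show ?case using h(3-8)
    by (intro exI[of _ q] exI[of _ "2 * q + p"] exI[of _ s] exI[of _ "2 * s + r"]) auto
qed

lemma br_plus_iterate_close:
  "\<bar>(br_plus ^^ n) 1 - (br_plus ^^ n) 0\<bar> \<le> 2 / (silver ^ 2) ^ n"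
proof -
  obtain p q r s :: real where h: "(br_plus ^^ n) 0 = p / q" "(br_plus ^^ n) 1 = r / s"
    "0 \<le> p" "p \<le> q" "0 < q" "0 \<le> r" "r \<le> s" "0 < s" "\<bar>r * q - p * s\<bar> = 1"
    "p + silver * q = silver ^ Suc n" "r + silver * s = (1 + silver) * silver ^ n"
    using br_plus_iterate_fractions by metis
  have "(1 + silver) * silver ^ n \<le> (1 + silver) * s" using h(7,11) by (simp add: distrib_right)
  then have s: "silver ^ n \<le> s" by (simp add: mult_le_cancel_left_pos add_pos_pos)
  have "silver * silver ^ n \<le> q + silver * q" using h(4,10) by simp
  also have "\<dots> \<le> silver * (2 * q)" using h(5) by (simp add: algebra_simps)
  finally have q: "silver ^ n \<le> 2 * q" by (simp add: mult_le_cancel_left_pos add_pos_pos)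
  have "(silver ^ 2) ^ n = silver ^ n * silver ^ n"
    by (simp only: power_mult[symmetric] power_add[symmetric] mult_2)
  also have "\<dots> \<le> (2 * q) * s" using q s h(5) by (intro mult_mono) auto
  finally have den: "(silver ^ 2) ^ n \<le> 2 * (q * s)" by simp
  have "(br_plus ^^ n) 1 - (br_plus ^^ n) 0 = (r * q - p * s) / (q * s)"
    using h by (simp add: field_simps)
  then have "\<bar>(br_plus ^^ n) 1 - (br_plus ^^ n) 0\<bar> = 2 / (2 * (q * s))"
    using h(5,8,9) by (simp add: abs_mult)
  also have "\<dots> \<le> 2 / (silver ^ 2) ^ n"
    by (intro frac_le den zero_less_power) (simp_all add: add_pos_pos)
  finally show ?thesis .
qed

theorem theorem2:
  fixes \<alpha> :: real
  assumes "\<alpha> = ln 3 / (2 * ln (1 + sqrt 2))"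
  shows "Q_E ` {0..1} \<subseteq> {0..1} \<and>
    holder_on \<alpha> {0..1} Q_E \<and>
    (\<forall>\<beta>>\<alpha>. \<not> holder_on \<beta> {0..1} Q_E)"
proof -
  define l where "l = silver ^ 2"
  have l: "1 < l" by (simp add: l_def one_less_power)
  have lnl: "ln l = 2 * ln silver" by (simp add: l_def ln_realpow add_pos_pos)
  have \<alpha>: "0 < \<alpha>" "l powr \<alpha> = 3"
  proof -
    show "0 < \<alpha>"
      unfolding assms by (intro divide_pos_pos mult_pos_pos ln_gt_zero) simp_all
    have "\<alpha> * ln l = ln 3" using l by (simp add: assms lnl[symmetric])
    then show "l powr \<alpha> = 3" using l by (simp add: powr_def)
  qed
  have "holder_on \<alpha> {0..1} Q_E"
    unfolding holder_on_def
  proof (intro exI[of _ 18] conjI ballI)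
    fix x y :: real
    assume xy: "x \<in> {0..1}" "y \<in> {0..1}"
    show "\<bar>Q_E x - Q_E y\<bar> \<le> 18 * \<bar>x - y\<bar> powr \<alpha>"
    proof (cases x y rule: linorder_cases)
      case less
      then show ?thesis
        using Q_E_holder_estimate[of \<alpha> x y] Q_E_mono[of x y] \<alpha> xy by (simp add: l_def)
    next
      case greater
      then show ?thesis
        using Q_E_holder_estimate[of \<alpha> y x] Q_E_mono[of y x] \<alpha> xy by (simp add: l_def)
    qed simp
  qed simp
  moreover have "\<not> holder_on \<beta> {0..1} Q_E" if \<beta>: "\<alpha> < \<beta>" for \<beta>
  proof
    assume "holder_on \<beta> {0..1} Q_E"
    then obtain C where C: "0 < C"
      "\<And>x y. x \<in> {0..1} \<Longrightarrow> y \<in> {0..1} \<Longrightarrow> \<bar>Q_E x - Q_E y\<bar> \<le> C * \<bar>x - y\<bar> powr \<beta>"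
      unfolding holder_on_def by blast
    \<comment> \<open>Comparing value and distance along the iterates bounds a geometric sequence whose ratio
      exceeds \<open>1\<close>.\<close>
    have bound: "(l powr \<beta> / 3) ^ n \<le> C * 2 powr \<beta>" for n
    proof -
      have "1 / 3 ^ n \<le> C * \<bar>(br_plus ^^ n) 1 - (br_plus ^^ n) 0\<bar> powr \<beta>"
        using C(2)[of "(br_plus ^^ n) 1" "(br_plus ^^ n) 0"]
          br_plus_iterate_unit[of 0 n] br_plus_iterate_unit[of 1 n]
        by (simp add: Q_E_br_plus_iterate)
      also have "\<dots> \<le> C * (2 / l ^ n) powr \<beta>"
        using C(1) \<alpha>(1) \<beta> br_plus_iterate_close[of n]
        by (intro mult_left_mono powr_mono2) (auto simp: l_def)
      also have "(2 / l ^ n) powr \<beta> = 2 powr \<beta> / (l powr \<beta>) ^ n"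
        using l by (simp add: powr_divide powr_realpow[symmetric] powr_powr mult.commute)
      finally show ?thesis using l by (simp add: power_divide field_simps)
    qed
    have "3 < l powr \<beta>" using \<alpha>(2) \<beta> l by (metis powr_less_mono)
    then obtain n where "C * 2 powr \<beta> < (l powr \<beta> / 3) ^ n"
      using real_arch_pow[of "l powr \<beta> / 3"] by auto
    then show False using bound[of n] by linarith
  qed
  moreover have "Q_E ` {0..1} \<subseteq> {0..1}" using Q_E_range by auto
  ultimately show ?thesis by blast
qed

end
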